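(* For all probabilistic regular expressions $e,f\in\mathsf{Exp}$ over a finite alphabet $A$: if $e\equiv f$, then $\llbracket e\rrbracket=\llbracket f\rrbracket$.
   Context: Fix a finite alphabet $A$. Probabilistic regular expressions are generated by the grammar $e,f ::= \mathsf{0}\mid \mathsf{1}\mid a\ (a\in A)\mid e\oplus_p f\mid e\,;f\mid e^{[p]}$ with $p\in[0,1]$; $\mathsf{Exp}$ denotes the set of all of them. For a set $X$, $\mathcal{D}X$ is the set of finitely supported subdistributions on $X$ (maps $\nu:X\to[0,1]$ with finite support and $\sum_x\nu(x)\le1$); $\delta_x$ is the Dirac subdistribution, $0$ the empty one. Write $\checkmark$ for the unique element of the one-point set and $FX=\{\checkmark\}+A\times X$. The Antimirov derivative $\partial:\mathsf{Exp}\to\mathcal{D}F\mathsf{Exp}$: $\partial(\mathsf{0})=0$, $\partial(\mathsf{1})=\delta_\checkmark$, $\partial(a)=\delta_{(a,\mathsf{1})}$, $\partial(e\oplus_p f)=p\partial(e)+(1-p)\partial(f)$; $\partial(e;f)(\checkmark)=\partial(e)(\checkmark)\partial(f)(\checkmark)$, $\partial(e;f)(a,g)=\partial(e)(\checkmark)\partial(f)(a,g)+\sum_{e':\ e';f=g}\partial(e)(a,e')$; if $p=1$ and $\partial(e)(\checkmark)=1$ then $\partial(e^{[p]})=0$, otherwise $\partial(e^{[p]})(\checkmark)=\frac{1-p}{1-p\partial(e)(\checkmark)}$, $\partial(e^{[p]})(a,e';e^{[p]})=\frac{p\partial(e)(a,e')}{1-p\partial(e)(\checkmark)}$ and $0$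 elsewhere. The language semantics $\llbracket e\rrbracket:A^*\to[0,1]$: $\llbracket e\rrbracket(\varepsilon)=\partial(e)(\checkmark)$, $\llbracket e\rrbracket(av)=\sum_{e'}\partial(e)(a,e')\llbracket e'\rrbracket(v)$. Termination function $E:\mathsf{Exp}\to[0,1]$: $E(\mathsf{1})=1$, $E(\mathsf{0})=E(a)=0$, $E(e\oplus_p f)=pE(e)+(1-p)E(f)$, $E(e;f)=E(e)E(f)$, $E(e^{[p]})=0$ if $E(e)=1$ and $p=1$, else $\frac{1-p}{1-pE(e)}$. Write $\bar p=1-p$. $\equiv$ is the least congruence on $\mathsf{Exp}$ containing, for all $e,f,g$, $p,q\in[0,1]$ (instances with a division only when the denominator is nonzero): (C1) $e\equiv e\oplus_pe$; (C2) $e\equiv e\oplus_1f$; (C3) $e\oplus_pf\equiv f\oplus_{\bar p}e$; (C4) $(e\oplus_pf)\oplus_qg\equiv e\oplus_{pq}(f\oplus_{\frac{\bar pq}{1-pq}}g)$; (D1) $(e\oplus_pf);g\equiv e;g\oplus_pf;g$; (D2) $e;(f\oplus_pg)\equiv e;f\oplus_pe;g$; (0S) $\mathsf{0};e\equiv\mathsf{0}$; (S0) $e;\mathsf{0}\equiv\mathsf{0}$; (1S) $\mathsf{1};e\equiv e$; (S1) $e;\mathsf{1}\equiv e$; (S) $e;(f;g)\equiv(e;f);g$; (Unroll) $e;e^{[p]}\oplus_p\mathsf{1}\equiv e^{[p]}$; (Tight) $(e\oplus_p\mathsf{1})^{[q]};\mathsf{1}\equiv e^{[\frac{pq}{1-\bar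 pq}]}$; (Div) $\mathsf{1}^{[1]}\equiv\mathsf{0}$; and closed under (Unique): if $g\equiv e;g\oplus_pf$ and $E(e)=0$ then $g\equiv e^{[p]};f$. *)

theory Defs
  imports Complex_Main
begin

typedef prob = "{0..1::real}"
  morphisms real_of_prob Prob
  by (rule exI[of _ 0]) simp

declare [[coercion real_of_prob]]

lemma real_of_prob_bounds: "0 \<le> real_of_prob p" "real_of_prob p \<le> 1"
  using real_of_prob[of p] by auto

datatype 'a exp =
    Zero  ("\<zero>")
  | One  ("\<one>")
  | Act 'a
  | Choice "'a exp" prob "'a exp"  ("(_ \<oplus>\<^bsub>_\<^esub> _)" [66, 0, 65] 65)
  | Seq "'a exp" "'a exp"  (infixr ";;" 70)
  | Loop "'a exp" prob  ("_\<^bsup>[_]\<^esup>" [1000, 0] 999)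

definition subdists :: "('x \<Rightarrow> real) set" where
  "subdists = {\<nu>. (\<forall>x. 0 \<le> \<nu> x \<and> \<nu> x \<le> 1) \<and> finite {x. \<nu> x \<noteq> 0} \<and>
     (\<Sum>x | \<nu> x \<noteq> 0. \<nu> x) \<le> 1}"

type_synonym ('a, 'x) F = "unit + 'a \<times> 'x"

abbreviation tick :: "('a, 'x) F"  ("\<checkmark>") where
  "\<checkmark> \<equiv> Inl ()"

abbreviation dirac :: "'x \<Rightarrow> 'x \<Rightarrow> real"  ("\<delta>") where
  "\<delta> x \<equiv> (\<lambda>y. if y = x then 1 else 0)"

text \<open>The derivative lives in the finitely supported subdistributions on \<open>F Exp\<close>; as a
  real-valued function its membership there is \<open>deriv_in_subdists\<close> below. The index sets of
  the two sums have at most one element, because \<open>Seq\<close> is injective.\<close>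

primrec deriv :: "'a exp \<Rightarrow> ('a, 'a exp) F \<Rightarrow> real"  ("\<partial>") where
  "\<partial> \<zero> = (\<lambda>x. 0)"
| "\<partial> \<one> = \<delta> \<checkmark>"
| "\<partial> (Act a) = \<delta> (Inr (a, \<one>))"
| "\<partial> (e \<oplus>\<^bsub>p\<^esub> f) = (\<lambda>x. p * \<partial> e x + (1 - p) * \<partial> f x)"
| "\<partial> (e ;; f) = (\<lambda>x. case x of
      Inl _ \<Rightarrow> \<partial> e \<checkmark> * \<partial> f \<checkmark>
    | Inr (a, g) \<Rightarrow> \<partial> e \<checkmark> * \<partial> f (Inr (a, g)) + (\<Sum>e' | e' ;; f = g. \<partial> e (Inr (a, e'))))"
| "\<partial> (e\<^bsup>[p]\<^esup>) = (\<lambda>x. if real_of_prob p = 1 \<and> \<partial> e \<checkmark> = 1 then 0 else case x of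
      Inl _ \<Rightarrow> (1 - p) / (1 - p * \<partial> e \<checkmark>)
    | Inr (a, g) \<Rightarrow> (\<Sum>e' | e' ;; e\<^bsup>[p]\<^esup> = g. p * \<partial> e (Inr (a, e')) / (1 - p * \<partial> e \<checkmark>)))"

text \<open>The sum ranges over a finite set, by \<open>deriv_in_subdists\<close> below.\<close>

primrec lang :: "'a list \<Rightarrow> 'a exp \<Rightarrow> real" where
  "lang [] e = \<partial> e \<checkmark>"
| "lang (a # v) e = (\<Sum>e' | \<partial> e (Inr (a, e')) \<noteq> 0. \<partial> e (Inr (a, e')) * lang v e')"

definition semantics :: "'a exp \<Rightarrow> 'a list \<Rightarrow> real" where
  "semantics e w = lang w e"

primrec E :: "'a exp \<Rightarrow> real" where
  "E \<zero> = 0"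
| "E \<one> = 1"
| "E (Act a) = 0"
| "E (e \<oplus>\<^bsub>p\<^esub> f) = p * E e + (1 - p) * E f"
| "E (e ;; f) = E e * E f"
| "E (e\<^bsup>[p]\<^esup>) = (if E e = 1 \<and> real_of_prob p = 1 then 0 else (1 - p) / (1 - p * E e))"

inductive equivalent :: "'a exp \<Rightarrow> 'a exp \<Rightarrow> bool"  (infix "\<approx>" 50) where
  refl: "e \<approx> e"
| sym: "e \<approx> f \<Longrightarrow> f \<approx> e"
| trans: "e \<approx> f \<Longrightarrow> f \<approx> g \<Longrightarrow> e \<approx> g"
| cong_Choice: "e \<approx> e' \<Longrightarrow> f \<approx> f' \<Longrightarrow> e \<oplus>\<^bsub>p\<^esub> f \<approx> e' \<oplus>\<^bsub>p\<^esub> f'"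
| cong_Seq: "e \<approx> e' \<Longrightarrow> f \<approx> f' \<Longrightarrow> e ;; f \<approx> e' ;; f'"
| cong_Loop: "e \<approx> e' \<Longrightarrow> e\<^bsup>[p]\<^esup> \<approx> e'\<^bsup>[p]\<^esup>"
| C1: "e \<approx> e \<oplus>\<^bsub>p\<^esub> e"
| C2: "e \<approx> e \<oplus>\<^bsub>Prob 1\<^esub> f"
| C3: "e \<oplus>\<^bsub>p\<^esub> f \<approx> f \<oplus>\<^bsub>Prob (1 - p)\<^esub> e"
| C4: "1 - p * q \<noteq> (0::real) \<Longrightarrow>
    (e \<oplus>\<^bsub>p\<^esub> f) \<oplus>\<^bsub>q\<^esub> g \<approx> e \<oplus>\<^bsub>Prob (p * q)\<^esub> (f \<oplus>\<^bsub>Prob ((1 - p) * q / (1 - p * q))\<^esub> g)"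
| D1: "(e \<oplus>\<^bsub>p\<^esub> f) ;; g \<approx> (e ;; g) \<oplus>\<^bsub>p\<^esub> (f ;; g)"
| D2: "e ;; (f \<oplus>\<^bsub>p\<^esub> g) \<approx> (e ;; f) \<oplus>\<^bsub>p\<^esub> (e ;; g)"
| ZeroS: "\<zero> ;; e \<approx> \<zero>"
| SZero: "e ;; \<zero> \<approx> \<zero>"
| OneS: "\<one> ;; e \<approx> e"
| SOne: "e ;; \<one> \<approx> e"
| S: "e ;; (f ;; g) \<approx> (e ;; f) ;; g"
| Unroll: "(e ;; e\<^bsup>[p]\<^esup>) \<oplus>\<^bsub>p\<^esub> \<one> \<approx> e\<^bsup>[p]\<^esup>"
| Tight: "1 - (1 - p) * q \<noteq> (0::real) \<Longrightarrow>
    (e \<oplus>\<^bsub>p\<^esub> \<one>)\<^bsup>[q]\<^esup> ;; \<one> \<approx> e\<^bsup>[Prob (p * q / (1 - (1 - p) * q))]\<^esup>"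
| Div: "\<one>\<^bsup>[Prob 1]\<^esup> \<approx> \<zero>"
| Unique: "g \<approx> (e ;; g) \<oplus>\<^bsub>p\<^esub> f \<Longrightarrow> E e = 0 \<Longrightarrow> g \<approx> e\<^bsup>[p]\<^esup> ;; f"

text \<open>Every argument of \<open>Prob\<close> in these rules lies in the unit interval, so \<open>Prob\<close> is never
  applied where it is unspecified.\<close>

lemma real_of_Prob_simps:
  fixes p q :: prob
  shows "real_of_prob (Prob 1) = 1"
    and "real_of_prob (Prob (1 - p)) = 1 - p"
    and "real_of_prob (Prob (p * q)) = p * q"
    and "1 - p * q \<noteq> (0::real) \<Longrightarrow>
      real_of_prob (Prob ((1 - p) * q / (1 - p * q))) = (1 - p) * q / (1 - p * q)"
    and "1 - (1 - p) * q \<noteq> (0::real) \<Longrightarrow>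
      real_of_prob (Prob (p * q / (1 - (1 - p) * q))) = p * q / (1 - (1 - p) * q)"
proof -
  define x y where "x = real_of_prob p" and "y = real_of_prob q"
  have b: "0 \<le> x" "x \<le> 1" "0 \<le> y" "y \<le> 1"
    unfolding x_def y_def by (rule real_of_prob_bounds)+
  have xy: "0 \<le> x * y" "x * y \<le> 1" "x * y \<le> y"
    using b by (auto simp: mult_le_one mult_left_le_one_le)
  show "real_of_prob (Prob 1) = 1" "real_of_prob (Prob (1 - p)) = 1 - p"
    by (rule Prob_inverse, use b in \<open>simp add: x_def\<close>)+
  show "real_of_prob (Prob (p * q)) = p * q"
    by (rule Prob_inverse) (use xy in \<open>simp add: x_def y_def\<close>)
  have "(1 - x) * y / (1 - x * y) \<in> {0..1}" if "1 - x * y \<noteq> 0"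
    using that b xy by (simp add: field_simps)
  then show "1 - p * q \<noteq> (0::real) \<Longrightarrow>
      real_of_prob (Prob ((1 - p) * q / (1 - p * q))) = (1 - p) * q / (1 - p * q)"
    unfolding x_def y_def by (rule Prob_inverse)
  have "x * y / (1 - (1 - x) * y) \<in> {0..1}" if ne: "1 - (1 - x) * y \<noteq> 0"
  proof -
    have "0 \<le> (1 - x) * y" "(1 - x) * y \<le> 1 - x * y"
      using b xy by (auto simp: algebra_simps)
    with ne xy show ?thesis by (auto simp: divide_simps)
  qed
  then show "1 - (1 - p) * q \<noteq> (0::real) \<Longrightarrow>
      real_of_prob (Prob (p * q / (1 - (1 - p) * q))) = p * q / (1 - (1 - p) * q)"
    unfolding x_def y_def by (rule Prob_inverse)
qed

lemma subdistsI:
  assumes nonneg: "\<And>x. 0 \<le> \<nu> x"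
    and R: "finite R" "{y. \<nu> (Inr y) \<noteq> 0} \<subseteq> R"
    and mass: "\<nu> \<checkmark> + (\<Sum>y\<in>R. \<nu> (Inr y)) \<le> 1"
  shows "\<nu> \<in> subdists"
proof -
  let ?S = "insert \<checkmark> (Inr ` R)"
  have S: "finite ?S" using R by simp
  have sub: "{x. \<nu> x \<noteq> 0} \<subseteq> ?S"
  proof
    fix x assume "x \<in> {x. \<nu> x \<noteq> 0}"
    then show "x \<in> ?S" using R(2) by (cases x) auto
  qed
  have "sum \<nu> ?S = \<nu> \<checkmark> + (\<Sum>y\<in>R. \<nu> (Inr y))"
    using R(1) by (subst sum.insert) (auto simp: sum.reindex)
  then have tot: "sum \<nu> ?S \<le> 1" using mass by simp
  have "\<nu> x \<le> 1" for x
  proof (cases "x \<in> ?S")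
    case True
    then have "\<nu> x \<le> sum \<nu> ?S" using nonneg S by (intro member_le_sum) auto
    then show ?thesis using tot by simp
  next
    case False
    then show ?thesis using sub by (metis (mono_tags, lifting) mem_Collect_eq subsetD zero_le_one)
  qed
  moreover have "sum \<nu> {x. \<nu> x \<noteq> 0} = sum \<nu> ?S"
    using S sub by (intro sum.mono_neutral_left) auto
  ultimately show ?thesis
    using nonneg tot finite_subset[OF sub S] by (simp add: subdists_def)
qed

lemma subdistsE:
  assumes "(\<nu> :: ('a, 'x) F \<Rightarrow> real) \<in> subdists"
  obtains R where "finite R" "{y. \<nu> (Inr y) \<noteq> 0} \<subseteq> R"
    "\<nu> \<checkmark> + (\<Sum>y\<in>R. \<nu> (Inr y)) \<le> 1" "\<And>x. 0 \<le> \<nu> x" "\<And>x. \<nu> x \<le> 1"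
proof
  let ?R = "{y. \<nu> (Inr y) \<noteq> 0}"
  have *: "finite {x. \<nu> x \<noteq> 0}" "sum \<nu> {x. \<nu> x \<noteq> 0} \<le> 1"
    and bounds: "\<And>x. 0 \<le> \<nu> x" "\<And>x. \<nu> x \<le> 1"
    using assms by (auto simp: subdists_def)
  have "Inr ` ?R \<subseteq> {x. \<nu> x \<noteq> 0}" by auto
  then have "finite (Inr ` ?R :: ('a, 'x) F set)" using *(1) by (rule finite_subset)
  then show R: "finite ?R" by (rule finite_imageD) simp
  show "?R \<subseteq> ?R" ..
  have sub: "{x. \<nu> x \<noteq> 0} \<subseteq> insert \<checkmark> (Inr ` ?R)"
  proof
    fix x assume "x \<in> {x. \<nu> x \<noteq> 0}"
    then show "x \<in> insert \<checkmark> (Inr ` ?R)" by (cases x) auto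
  qed
  have "sum \<nu> {x. \<nu> x \<noteq> 0} = sum \<nu> (insert \<checkmark> (Inr ` ?R))"
    using R sub by (intro sum.mono_neutral_left) auto
  also have "\<dots> = \<nu> \<checkmark> + (\<Sum>y\<in>?R. \<nu> (Inr y))"
    using R by (subst sum.insert) (auto simp: sum.reindex)
  finally show "\<nu> \<checkmark> + (\<Sum>y\<in>?R. \<nu> (Inr y)) \<le> 1" using *(2) by simp
  show "\<And>x. 0 \<le> \<nu> x" "\<And>x. \<nu> x \<le> 1" by (fact bounds)+
qed

lemma deriv_in_subdists: "\<partial> e \<in> subdists"
proof (induction e)
  case Zero
  show ?case by (rule subdistsI[where R = "{}"]) auto
next
  case One
  show ?case by (rule subdistsI[where R = "{}"]) auto
next
  case (Act a)
  show ?case by (rule subdistsI[where R = "{(a, \<one>)}"]) auto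
next
  case (Choice e p f)
  obtain R where R: "finite R" "{y. \<partial> e (Inr y) \<noteq> 0} \<subseteq> R"
    "\<partial> e \<checkmark> + (\<Sum>y\<in>R. \<partial> e (Inr y)) \<le> 1" "\<And>x. 0 \<le> \<partial> e x" "\<And>x. \<partial> e x \<le> 1"
    using Choice(1) by (rule subdistsE) blast
  obtain Q where Q: "finite Q" "{y. \<partial> f (Inr y) \<noteq> 0} \<subseteq> Q"
    "\<partial> f \<checkmark> + (\<Sum>y\<in>Q. \<partial> f (Inr y)) \<le> 1" "\<And>x. 0 \<le> \<partial> f x" "\<And>x. \<partial> f x \<le> 1"
    using Choice(2) by (rule subdistsE) blast
  have p: "0 \<le> real_of_prob p" "real_of_prob p \<le> 1" by (rule real_of_prob_bounds)+
  have sR: "(\<Sum>y\<in>R \<union> Q. \<partial> e (Inr y)) = (\<Sum>y\<in>R. \<partial> e (Inr y))"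
    using R Q by (intro sum.mono_neutral_right) auto
  have sQ: "(\<Sum>y\<in>R \<union> Q. \<partial> f (Inr y)) = (\<Sum>y\<in>Q. \<partial> f (Inr y))"
    using R Q by (intro sum.mono_neutral_right) auto
  show ?case
  proof (rule subdistsI[where R = "R \<union> Q"])
    show "0 \<le> \<partial> (e \<oplus>\<^bsub>p\<^esub> f) x" for x using R(4) Q(4) p by simp
    show "finite (R \<union> Q)" using R Q by simp
    show "{y. \<partial> (e \<oplus>\<^bsub>p\<^esub> f) (Inr y) \<noteq> 0} \<subseteq> R \<union> Q" using R(2) Q(2) by force
    have "\<partial> (e \<oplus>\<^bsub>p\<^esub> f) \<checkmark> + (\<Sum>y\<in>R \<union> Q. \<partial> (e \<oplus>\<^bsub>p\<^esub> f) (Inr y)) =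
        p * (\<partial> e \<checkmark> + (\<Sum>y\<in>R. \<partial> e (Inr y))) + (1 - p) * (\<partial> f \<checkmark> + (\<Sum>y\<in>Q. \<partial> f (Inr y)))"
      by (simp add: sum.distrib sR sQ flip: sum_distrib_left) (simp add: algebra_simps)
    also have "\<dots> \<le> p * 1 + (1 - p) * 1"
      using R(3) Q(3) p by (intro add_mono mult_left_mono) auto
    finally show "\<partial> (e \<oplus>\<^bsub>p\<^esub> f) \<checkmark> + (\<Sum>y\<in>R \<union> Q. \<partial> (e \<oplus>\<^bsub>p\<^esub> f) (Inr y)) \<le> 1" by simp
  qed
next
  case (Seq e f)
  obtain R where R: "finite R" "{y. \<partial> e (Inr y) \<noteq> 0} \<subseteq> R"
    "\<partial> e \<checkmark> + (\<Sum>y\<in>R. \<partial> e (Inr y)) \<le> 1" "\<And>x. 0 \<le> \<partial> e x" "\<And>x. \<partial> e x \<le> 1"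
    using Seq(1) by (rule subdistsE) blast
  obtain Q where Q: "finite Q" "{y. \<partial> f (Inr y) \<noteq> 0} \<subseteq> Q"
    "\<partial> f \<checkmark> + (\<Sum>y\<in>Q. \<partial> f (Inr y)) \<le> 1" "\<And>x. 0 \<le> \<partial> f x" "\<And>x. \<partial> f x \<le> 1"
    using Seq(2) by (rule subdistsE) blast
  define h where "h = (\<lambda>(a :: 'a, e'). (a, e' ;; f))"
  define k where "k = (\<lambda>(a, g). \<Sum>e' | e' ;; f = g. \<partial> e (Inr (a, e')))"
  have inj: "inj_on h R" by (auto simp: h_def inj_on_def)
  have kh: "k (h y) = \<partial> e (Inr y)" for y by (cases y) (simp add: k_def h_def)
  have k0: "k y = 0" if "y \<notin> h ` R" for y
  proof -
    obtain a g where y: "y = (a, g)" by (cases y)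
    have "\<partial> e (Inr (a, e')) = 0" if "e' ;; f = g" for e'
      using R(2) \<open>y \<notin> h ` R\<close> that y by (force simp: h_def)
    then show ?thesis unfolding k_def y by (auto intro: sum.neutral)
  qed
  have k_nonneg: "0 \<le> k y" for y
    by (cases y) (auto simp: k_def intro!: sum_nonneg R(4))
  have d: "\<partial> (e ;; f) (Inr y) = \<partial> e \<checkmark> * \<partial> f (Inr y) + k y" for y
    by (cases y) (simp add: k_def)
  have sk: "(\<Sum>y\<in>h ` R \<union> Q. k y) = (\<Sum>y\<in>R. \<partial> e (Inr y))"
  proof -
    have "(\<Sum>y\<in>h ` R \<union> Q. k y) = (\<Sum>y\<in>h ` R. k y)"
      using R(1) Q(1) k0 by (intro sum.mono_neutral_right) auto
    then show ?thesis using inj by (simp add: sum.reindex kh)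
  qed
  have sQ: "(\<Sum>y\<in>h ` R \<union> Q. \<partial> f (Inr y)) = (\<Sum>y\<in>Q. \<partial> f (Inr y))"
    using R Q by (intro sum.mono_neutral_right) auto
  show ?case
  proof (rule subdistsI[where R = "h ` R \<union> Q"])
    show "0 \<le> \<partial> (e ;; f) x" for x
    proof (cases x)
      case (Inl u)
      then show ?thesis using R(4) Q(4) by simp
    next
      case (Inr y)
      then show ?thesis using R(4) Q(4) k_nonneg[of y] by (simp only: d) simp
    qed
    show "finite (h ` R \<union> Q)" using R Q by simp
    show "{y. \<partial> (e ;; f) (Inr y) \<noteq> 0} \<subseteq> h ` R \<union> Q"
      unfolding d using k0 Q(2) by fastforce
    have "\<partial> (e ;; f) \<checkmark> + (\<Sum>y\<in>h ` R \<union> Q. \<partial> (e ;; f) (Inr y)) =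
        \<partial> e \<checkmark> * (\<partial> f \<checkmark> + (\<Sum>y\<in>Q. \<partial> f (Inr y))) + (\<Sum>y\<in>R. \<partial> e (Inr y))"
      unfolding d sum.distrib sk sum_distrib_left[symmetric] sQ by (simp add: algebra_simps)
    also have "\<dots> \<le> \<partial> e \<checkmark> * 1 + (\<Sum>y\<in>R. \<partial> e (Inr y))"
      using Q(3) R(4) by (intro add_mono mult_left_mono) auto
    also have "\<dots> \<le> 1" using R(3) by simp
    finally show "\<partial> (e ;; f) \<checkmark> + (\<Sum>y\<in>h ` R \<union> Q. \<partial> (e ;; f) (Inr y)) \<le> 1" .
  qed
next
  case (Loop e p)
  obtain R where R: "finite R" "{y. \<partial> e (Inr y) \<noteq> 0} \<subseteq> R"
    "\<partial> e \<checkmark> + (\<Sum>y\<in>R. \<partial> e (Inr y)) \<le> 1" "\<And>x. 0 \<le> \<partial> e x" "\<And>x. \<partial> e x \<le> 1"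
    using Loop by (rule subdistsE) blast
  have p: "0 \<le> real_of_prob p" "real_of_prob p \<le> 1" by (rule real_of_prob_bounds)+
  show ?case
  proof (cases "real_of_prob p = 1 \<and> \<partial> e \<checkmark> = 1")
    case True
    then show ?thesis by (intro subdistsI[where R = "{}"]) auto
  next
    case False
    let ?D = "1 - p * \<partial> e \<checkmark>"
    have D: "0 < ?D"
    proof (cases "real_of_prob p = 1")
      case True
      then show ?thesis using False R(5)[of "\<checkmark>"] by simp
    next
      case pn: False
      have "p * \<partial> e \<checkmark> \<le> p * 1" using p R(5) by (intro mult_left_mono) auto
      then show ?thesis using p pn by simp
    qed
    define h where "h = (\<lambda>(a :: 'a, e'). (a, e' ;; e\<^bsup>[p]\<^esup>))"
    define k where "k = (\<lambda>(a, g). \<Sum>e' | e' ;; e\<^bsup>[p]\<^esup> = g. p * \<partial> e (Inr (a, e')) / ?D)"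
    have inj: "inj_on h R" by (auto simp: h_def inj_on_def)
    have kh: "k (h y) = p * \<partial> e (Inr y) / ?D" for y by (cases y) (simp add: k_def h_def)
    have k0: "k y = 0" if "y \<notin> h ` R" for y
    proof -
      obtain a g where y: "y = (a, g)" by (cases y)
      have "\<partial> e (Inr (a, e')) = 0" if "e' ;; e\<^bsup>[p]\<^esup> = g" for e'
        using R(2) \<open>y \<notin> h ` R\<close> that y by (force simp: h_def)
      then show ?thesis unfolding k_def y by (auto intro: sum.neutral)
    qed
    have k_nonneg: "0 \<le> k y" for y
      using D p R(4) by (cases y) (auto simp: k_def intro!: sum_nonneg)
    have d: "\<partial> (e\<^bsup>[p]\<^esup>) (Inr y) = k y" for y
      using False by (cases y) (auto simp: k_def)
    have t: "\<partial> (e\<^bsup>[p]\<^esup>) \<checkmark> = (1 - p) / ?D" using False by auto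
    show ?thesis
    proof (rule subdistsI[where R = "h ` R"])
      show "0 \<le> \<partial> (e\<^bsup>[p]\<^esup>) x" for x
      proof (cases x)
        case (Inl u)
        then show ?thesis using t D p by simp
      next
        case (Inr y)
        then show ?thesis using k_nonneg[of y] by (simp only: d)
      qed
      show "finite (h ` R)" using R by simp
      show "{y. \<partial> (e\<^bsup>[p]\<^esup>) (Inr y) \<noteq> 0} \<subseteq> h ` R" unfolding d using k0 by blast
      have "\<partial> (e\<^bsup>[p]\<^esup>) \<checkmark> + (\<Sum>y\<in>h ` R. \<partial> (e\<^bsup>[p]\<^esup>) (Inr y)) =
          (1 - p) / ?D + (\<Sum>y\<in>R. p * \<partial> e (Inr y) / ?D)"
        unfolding t d using inj by (simp add: sum.reindex kh)
      also have "\<dots> = (1 - p + p * (\<Sum>y\<in>R. \<partial> e (Inr y))) / ?D"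
        by (simp add: add_divide_distrib sum_distrib_left sum_divide_distrib)
      also have "\<dots> \<le> 1"
      proof -
        have "p * (\<Sum>y\<in>R. \<partial> e (Inr y)) \<le> p * (1 - \<partial> e \<checkmark>)"
          using R(3) p by (intro mult_left_mono) auto
        then show ?thesis using D by (simp add: algebra_simps)
      qed
      finally show "\<partial> (e\<^bsup>[p]\<^esup>) \<checkmark> + (\<Sum>y\<in>h ` R. \<partial> (e\<^bsup>[p]\<^esup>) (Inr y)) \<le> 1" .
    qed
  qed
qed

lemma semantics_bounds: "0 \<le> semantics e w" "semantics e w \<le> 1"
proof -
  have "0 \<le> lang w e \<and> lang w e \<le> 1"
  proof (induction w arbitrary: e)
    case Nil
    show ?case using deriv_in_subdists[of e] by (auto simp: subdists_def)
  next
    case (Cons a v)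
    obtain R where R: "finite R" "{y. \<partial> e (Inr y) \<noteq> 0} \<subseteq> R"
      "\<partial> e \<checkmark> + (\<Sum>y\<in>R. \<partial> e (Inr y)) \<le> 1" "\<And>x. 0 \<le> \<partial> e x" "\<And>x. \<partial> e x \<le> 1"
      using deriv_in_subdists by (rule subdistsE) blast
    let ?T = "{e'. \<partial> e (Inr (a, e')) \<noteq> 0}"
    have T: "Pair a ` ?T \<subseteq> R" using R(2) by auto
    have "lang (a # v) e \<le> (\<Sum>e'\<in>?T. \<partial> e (Inr (a, e')))"
      using Cons R(4) by (auto intro!: sum_mono mult_left_le)
    also have "\<dots> = (\<Sum>y\<in>Pair a ` ?T. \<partial> e (Inr y))"
      by (subst sum.reindex) (auto simp: inj_on_def)
    also have "\<dots> \<le> (\<Sum>y\<in>R. \<partial> e (Inr y))"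
      using R(1) T R(4) by (intro sum_mono2) auto
    also have "\<dots> \<le> 1" using R(3) R(4)[of "\<checkmark>"] by linarith
    finally show ?case using Cons R(4) by (auto intro!: sum_nonneg)
  qed
  then show "0 \<le> semantics e w" "semantics e w \<le> 1" by (simp_all add: semantics_def)
qed

end

theory Submission
  imports Defs
begin

text \<open>The semantics is compositional: sequencing is the Cauchy product of weighted languages, and a
  loop is determined by its value at the empty word and a recursion along the word which only
  involves the language of the body. Hence every congruence rule and axiom reduces to an identity
  between weighted languages. For \<open>Unique\<close>, the map \<open>L \<mapsto> p e L + (1 - p) f\<close> has at most one fixed
  point if \<open>e\<close> vanishes at the empty word, because the value of \<open>e L\<close> at a word then depends only on
  strictly shorter words.\<close>

section \<open>Cauchy product of weighted languages\<close>

text \<open>The sum of \<open>f u * g v\<close> over all splittings of the word into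
  \<open>u @ v\<close>. Peeling letters off the left factor keeps it in step with the recursion of
  \<open>lang\<close>; the first summand at \<open>a # w\<close> is the splitting with empty
  \<open>u\<close>.\<close>

primrec conv :: "('a list \<Rightarrow> 'b) \<Rightarrow> ('a list \<Rightarrow> 'b) \<Rightarrow> 'a list \<Rightarrow> 'b::comm_semiring_0" where
  "conv f g [] = f [] * g []"
| "conv f g (a # w) = f [] * g (a # w) + conv (\<lambda>v. f (a # v)) g w"

lemma conv_add_left: "conv (\<lambda>v. f v + g v) h w = conv f h w + conv g h w"
  by (induction w arbitrary: f g) (simp_all add: algebra_simps)

lemma conv_scale_left: "conv (\<lambda>v. c * f v) h w = c * conv f h w"
  by (induction w arbitrary: f) (simp_all add: algebra_simps)

lemma conv_zero_left: "conv (\<lambda>v. 0) h w = 0"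
  by (induction w) simp_all

lemma conv_sum_left: "conv (\<lambda>v. \<Sum>x\<in>A. f x v) h w = (\<Sum>x\<in>A. conv (f x) h w)"
  by (induction A rule: infinite_finite_induct) (simp_all add: conv_add_left conv_zero_left)

lemma conv_add_right: "conv f (\<lambda>v. g v + h v) w = conv f g w + conv f h w"
  by (induction w arbitrary: f) (simp_all add: algebra_simps)

lemma conv_scale_right: "conv f (\<lambda>v. c * g v) w = c * conv f g w"
  by (induction w arbitrary: f) (simp_all add: algebra_simps)

lemma conv_zero_right: "conv f (\<lambda>v. 0) w = 0"
  by (induction w arbitrary: f) simp_all

text \<open>The letter derivative of \<open>conv f g\<close> is a multiple of that of
  \<open>g\<close> plus a product with that of \<open>f\<close>; linearity in the left factor
  separates the two.\<close>

lemma conv_assoc: "conv (conv f g) h w = conv f (conv g h) w"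
  by (induction w arbitrary: f) (simp_all add: conv_add_left conv_scale_left algebra_simps)

lemma conv_one_left: "conv (\<lambda>v. if v = [] then 1 else 0) g w = (g w :: 'b::comm_semiring_1)"
  by (cases w) (simp_all add: conv_zero_left)

lemma conv_one_right: "conv f (\<lambda>v. if v = [] then 1 else 0) w = (f w :: 'b::comm_semiring_1)"
  by (induction w arbitrary: f) simp_all

text \<open>The right factor is evaluated only at suffixes of \<open>w\<close>; this drives the
  inductions on length.\<close>

lemma conv_cong_right:
  "(\<And>v. length v \<le> length w \<Longrightarrow> g v = h v) \<Longrightarrow> conv f g w = conv f h w"
  by (induction w arbitrary: f) simp_all

section \<open>Uniqueness of solutions of language equations\<close>

text \<open>The product at \<open>w\<close> sees \<open>L\<close> only on words shorter than
  \<open>a # w\<close>, so induction on length applies whatever \<open>f []\<close> is.\<close>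

lemma loop_unique:
  assumes "L [] = L' []"
    and L: "\<And>a w. L (a # w) = k * conv (\<lambda>v. f (a # v)) L w"
    and L': "\<And>a w. L' (a # w) = k * conv (\<lambda>v. f (a # v)) L' w"
  shows "L = L'"
proof
  show "L w = L' w" for w
  proof (induction w rule: length_induct)
    case (1 w)
    show ?case
    proof (cases w)
      case (Cons a v)
      then have "conv (\<lambda>v. f (a # v)) L v = conv (\<lambda>v. f (a # v)) L' v"
        using 1 by (intro conv_cong_right) simp
      then show ?thesis by (simp add: Cons L L')
    qed (simp add: assms(1))
  qed
qed

lemma affine_fixpoint_unique:
  assumes f: "f [] = 0"
    and L: "\<And>w. L w = k * conv f L w + b w"
    and L': "\<And>w. L' w = k * conv f L' w + b w"
  shows "L = L'"
proof
  show "L w = L' w" for w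
  proof (induction w rule: length_induct)
    case (1 w)
    have "conv f L w = conv f L' w"
    proof (cases w)
      case (Cons a v)
      then have "conv (\<lambda>v. f (a # v)) L v = conv (\<lambda>v. f (a # v)) L' v"
        using 1 by (intro conv_cong_right) simp
      \<comment> \<open>\<open>f [] = 0\<close> removes the summand \<open>f [] * L (a # v)\<close>,
        the only one that evaluates \<open>L\<close> at the full word.\<close>
      then show ?thesis using f by (simp add: Cons)
    qed (simp add: f)
    then show ?case using L[of w] L'[of w] by simp
  qed
qed

section \<open>Semantics of choice and sequencing\<close>

lemma finite_deriv_support: "finite {e'. \<partial> e (Inr (a, e')) \<noteq> 0}"
proof -
  have "finite {x. \<partial> e x \<noteq> 0}" using deriv_in_subdists[of e] by (simp add: subdists_def)
  then have "finite ((\<lambda>e'. Inr (a, e')) -` {x. \<partial> e x \<noteq> 0})"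
    by (rule finite_vimageI) (simp add: inj_on_def)
  then show ?thesis by (simp add: vimage_def)
qed

lemma semantics_Nil [simp]: "semantics e [] = \<partial> e \<checkmark>"
  by (simp add: semantics_def)

text \<open>The freedom to enlarge the index set lets sums belonging to different expressions be
  combined.\<close>

lemma semantics_Cons:
  assumes "finite A" "{e'. \<partial> e (Inr (a, e')) \<noteq> 0} \<subseteq> A"
  shows "semantics e (a # v) = (\<Sum>e'\<in>A. \<partial> e (Inr (a, e')) * semantics e' v)"
  unfolding semantics_def lang.simps using assms by (intro sum.mono_neutral_left) auto

lemma semantics_Zero [simp]: "semantics \<zero> w = 0"
  by (cases w) (simp_all add: semantics_def)

lemma semantics_One: "semantics \<one> w = (if w = [] then 1 else 0)"
  by (cases w) (simp_all add: semantics_def)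

lemma semantics_Choice: "semantics (e \<oplus>\<^bsub>p\<^esub> f) w = p * semantics e w + (1 - p) * semantics f w"
proof (cases w)
  case (Cons a v)
  let ?A = "{e'. \<partial> e (Inr (a, e')) \<noteq> 0} \<union> {e'. \<partial> f (Inr (a, e')) \<noteq> 0}"
  have A: "finite ?A" by (simp add: finite_deriv_support)
  have "semantics g (a # v) = (\<Sum>e'\<in>?A. \<partial> g (Inr (a, e')) * semantics e' v)"
    if "g \<in> {e, f, e \<oplus>\<^bsub>p\<^esub> f}" for g
    using that A by (intro semantics_Cons) auto
  then show ?thesis
    by (simp add: Cons algebra_simps sum.distrib sum_distrib_left sum_subtractf)
qed simp

text \<open>Change of variables along the injective map \<open>\<lambda>x. x ;; f\<close>, whose
  fibres have at most one element. \<open>B\<close> may exceed the image, to leave room for other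
  successors.\<close>

lemma sum_over_Seq_fibres:
  assumes "finite B" "(\<lambda>x. x ;; f) ` {x. \<phi> x \<noteq> 0} \<subseteq> B" "finite {x. \<phi> x \<noteq> 0}"
  shows "(\<Sum>g\<in>B. (\<Sum>x | x ;; f = g. \<phi> x) * \<psi> g) = (\<Sum>x | \<phi> x \<noteq> 0. \<phi> x * (\<psi> (x ;; f) :: real))"
proof -
  let ?h = "\<lambda>x. x ;; f"
  have "(\<Sum>x | x ;; f = g. \<phi> x) = 0" if "g \<notin> ?h ` {x. \<phi> x \<noteq> 0}" for g
    using that by (intro sum.neutral) auto
  then have "(\<Sum>g\<in>B. (\<Sum>x | x ;; f = g. \<phi> x) * \<psi> g) =
      (\<Sum>g\<in>?h ` {x. \<phi> x \<noteq> 0}. (\<Sum>x | x ;; f = g. \<phi> x) * \<psi> g)"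
    using assms by (intro sum.mono_neutral_right) auto
  also have "\<dots> = (\<Sum>x | \<phi> x \<noteq> 0. \<phi> x * \<psi> (x ;; f))"
    by (subst sum.reindex) (auto simp: inj_on_def)
  finally show ?thesis .
qed

lemma sum_Seq_fibre_nonzero:
  "(\<Sum>x | x ;; f = g. \<phi> x) \<noteq> (0::real) \<Longrightarrow> g \<in> (\<lambda>x. x ;; f) ` {x. \<phi> x \<noteq> 0}"
  by (erule contrapos_np) (auto intro!: sum.neutral)

lemma semantics_Seq_Cons:
  "semantics (e ;; f) (a # v) = \<partial> e \<checkmark> * semantics f (a # v) +
    (\<Sum>x | \<partial> e (Inr (a, x)) \<noteq> 0. \<partial> e (Inr (a, x)) * semantics (x ;; f) v)"
proof -
  let ?S = "{x. \<partial> e (Inr (a, x)) \<noteq> 0}" and ?T = "{x. \<partial> f (Inr (a, x)) \<noteq> 0}"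
  \<comment> \<open>The two kinds of successors may overlap; this is harmless because the sum over
    \<open>?B\<close> is split by linearity.\<close>
  let ?B = "(\<lambda>x. x ;; f) ` ?S \<union> ?T"
  have B: "finite ?B" by (simp add: finite_deriv_support)
  have "{g. \<partial> (e ;; f) (Inr (a, g)) \<noteq> 0} \<subseteq> ?B"
    using sum_Seq_fibre_nonzero[where \<phi> = "\<lambda>x. \<partial> e (Inr (a, x))" and f = f] by fastforce
  then have "semantics (e ;; f) (a # v) = (\<Sum>g\<in>?B. \<partial> (e ;; f) (Inr (a, g)) * semantics g v)"
    by (rule semantics_Cons[OF B])
  also have "\<dots> = \<partial> e \<checkmark> * (\<Sum>g\<in>?B. \<partial> f (Inr (a, g)) * semantics g v) +
      (\<Sum>g\<in>?B. (\<Sum>x | x ;; f = g. \<partial> e (Inr (a, x))) * semantics g v)"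
    by (simp add: distrib_right sum.distrib sum_distrib_left mult.assoc)
  also have "(\<Sum>g\<in>?B. \<partial> f (Inr (a, g)) * semantics g v) = semantics f (a # v)"
    by (rule semantics_Cons[OF B, symmetric]) auto
  also have "(\<Sum>g\<in>?B. (\<Sum>x | x ;; f = g. \<partial> e (Inr (a, x))) * semantics g v) =
      (\<Sum>x\<in>?S. \<partial> e (Inr (a, x)) * semantics (x ;; f) v)"
    by (rule sum_over_Seq_fibres[OF B]) (auto simp: finite_deriv_support)
  finally show ?thesis .
qed

lemma conv_semantics_Cons:
  "conv (\<lambda>u. semantics e (a # u)) g v =
    (\<Sum>x | \<partial> e (Inr (a, x)) \<noteq> 0. \<partial> e (Inr (a, x)) * conv (semantics x) g v)"
  by (simp add: semantics_Cons[OF finite_deriv_support order.refl] conv_sum_left conv_scale_left)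

text \<open>Reading a letter replaces \<open>e\<close> by a residual and keeps \<open>f\<close>,
  hence the induction on the word with \<open>e\<close> arbitrary.\<close>

lemma semantics_Seq: "semantics (e ;; f) w = conv (semantics e) (semantics f) w"
proof (induction w arbitrary: e)
  case (Cons a v)
  show ?case by (simp add: semantics_Seq_Cons Cons conv_semantics_Cons)
qed simp

section \<open>Semantics of loops\<close>

text \<open>The factor is \<open>p\<close> times the geometric series in
  \<open>p * \<partial> e \<checkmark>\<close>, which accounts for passes that read no letter. Each
  successor is a residual of the body followed by the loop, so \<open>semantics_Seq\<close> turns
  the sum into a product.\<close>

lemma semantics_Loop_Cons:
  assumes "\<not> (real_of_prob p = 1 \<and> \<partial> e \<checkmark> = 1)"
  shows "semantics (e\<^bsup>[p]\<^esup>) (a # v) =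
    p / (1 - p * \<partial> e \<checkmark>) * conv (\<lambda>u. semantics e (a # u)) (semantics (e\<^bsup>[p]\<^esup>)) v"
proof -
  let ?S = "{x. \<partial> e (Inr (a, x)) \<noteq> 0}" and ?L = "e\<^bsup>[p]\<^esup>"
  let ?B = "(\<lambda>x. x ;; ?L) ` ?S" and ?c = "p / (1 - p * \<partial> e \<checkmark>)"
  have B: "finite ?B" by (simp add: finite_deriv_support)
  have d: "\<partial> ?L (Inr (a, g)) = ?c * (\<Sum>x | x ;; ?L = g. \<partial> e (Inr (a, x)))" for g
    using assms by (auto simp: sum_distrib_left)
  have "{g. \<partial> ?L (Inr (a, g)) \<noteq> 0} \<subseteq> ?B"
    unfolding d using sum_Seq_fibre_nonzero[where \<phi> = "\<lambda>x. \<partial> e (Inr (a, x))" and f = ?L] by fastforce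
  then have "semantics ?L (a # v) = (\<Sum>g\<in>?B. \<partial> ?L (Inr (a, g)) * semantics g v)"
    by (rule semantics_Cons[OF B])
  also have "\<dots> = ?c * (\<Sum>g\<in>?B. (\<Sum>x | x ;; ?L = g. \<partial> e (Inr (a, x))) * semantics g v)"
    unfolding d by (simp only: sum_distrib_left[symmetric] mult.assoc)
  also have "(\<Sum>g\<in>?B. (\<Sum>x | x ;; ?L = g. \<partial> e (Inr (a, x))) * semantics g v) =
      (\<Sum>x\<in>?S. \<partial> e (Inr (a, x)) * semantics (x ;; ?L) v)"
    by (rule sum_over_Seq_fibres[OF B]) (auto simp: finite_deriv_support)
  also have "\<dots> = conv (\<lambda>u. semantics e (a # u)) (semantics ?L) v"
    by (simp only: conv_semantics_Cons semantics_Seq)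
  finally show ?thesis .
qed

lemma semantics_Loop_degenerate:
  assumes "real_of_prob p = 1" "\<partial> e \<checkmark> = 1"
  shows "semantics (e\<^bsup>[p]\<^esup>) w = 0"
  using assms by (cases w) (simp_all add: semantics_def)

text \<open>A product of two numbers in the unit interval is at most either factor, so it equals 1
  only if both do.\<close>

lemma loop_denominator_nonzero:
  assumes "\<not> (real_of_prob p = 1 \<and> \<partial> e \<checkmark> = 1)"
  shows "1 - p * \<partial> e \<checkmark> \<noteq> 0"
proof
  assume *: "1 - p * \<partial> e \<checkmark> = 0"
  have b: "0 \<le> \<partial> e \<checkmark>" "\<partial> e \<checkmark> \<le> 1" "0 \<le> real_of_prob p" "real_of_prob p \<le> 1"
    using semantics_bounds[of e "[]"] real_of_prob_bounds[of p] by simp_all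
  then have "p * \<partial> e \<checkmark> \<le> p" "p * \<partial> e \<checkmark> \<le> \<partial> e \<checkmark>"
    by (intro mult_left_le mult_left_le_one_le; simp)+
  then show False using assms * b by linarith
qed

lemma semantics_Loop_cong:
  assumes "semantics e = semantics f"
  shows "semantics (e\<^bsup>[p]\<^esup>) = semantics (f\<^bsup>[p]\<^esup>)"
proof -
  \<comment> \<open>The degenerate case depends only on the value of the body at the empty word, so
    both loops are degenerate together.\<close>
  have t: "\<partial> e \<checkmark> = \<partial> f \<checkmark>" using fun_cong[OF assms, of "[]"] by simp
  show ?thesis
  proof (cases "real_of_prob p = 1 \<and> \<partial> e \<checkmark> = 1")
    case True
    then show ?thesis by (simp add: fun_eq_iff semantics_Loop_degenerate t)
  next
    case False
    show ?thesis
      by (rule loop_unique[where k = "p / (1 - p * \<partial> e \<checkmark>)" and f = "semantics e"])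
        (use False in \<open>simp_all add: t assms semantics_Loop_Cons\<close>)
  qed
qed

lemma semantics_Unroll:
  "semantics (e\<^bsup>[p]\<^esup>) w =
    p * conv (semantics e) (semantics (e\<^bsup>[p]\<^esup>)) w + (1 - p) * (if w = [] then 1 else 0)"
proof (cases "real_of_prob p = 1 \<and> \<partial> e \<checkmark> = 1")
  case True
  then have "semantics (e\<^bsup>[p]\<^esup>) = (\<lambda>w. 0)" by (simp add: fun_eq_iff semantics_Loop_degenerate)
  then show ?thesis using True by (simp add: conv_zero_right)
next
  case False
  note nz = loop_denominator_nonzero[OF False]
  show ?thesis
  proof (cases w)
    case Nil
    then show ?thesis using False nz by (auto simp: field_simps)
  next
    case (Cons a v)
    \<comment> \<open>With \<open>x\<close> the value of the loop at \<open>a # v\<close> and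
      \<open>c\<close> that of \<open>e\<close> at the empty word, the product at
      \<open>a # v\<close> is \<open>c * x + y\<close>. The recursion is this equation solved for
      \<open>x\<close>.\<close>
    have "\<And>t c x y :: real. 1 - t * c \<noteq> 0 \<Longrightarrow> x = t / (1 - t * c) * y \<Longrightarrow> x = t * (c * x + y)"
      by (simp add: field_simps)
    from this[OF nz semantics_Loop_Cons[OF False, of a v]] show ?thesis by (simp add: Cons)
  qed
qed

text \<open>On nonempty words \<open>\<one>\<close> contributes nothing, so the letter derivatives
  of the left body are \<open>p\<close> times those of \<open>e\<close>. Both loops then obey one
  recursion once the constants are matched.\<close>

lemma semantics_Tight:
  assumes ne: "1 - (1 - p) * q \<noteq> (0::real)"
  shows "semantics ((e \<oplus>\<^bsub>p\<^esub> \<one>)\<^bsup>[q]\<^esup>) = semantics (e\<^bsup>[Prob (p * q / (1 - (1 - p) * q))]\<^esup>)"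
proof -
  let ?e = "e \<oplus>\<^bsub>p\<^esub> \<one>" and ?r = "Prob (p * q / (1 - (1 - p) * q))"
  have r: "real_of_prob ?r = p * q / (1 - (1 - p) * q)" using ne by (rule real_of_Prob_simps)
  have t: "\<partial> ?e \<checkmark> = p * \<partial> e \<checkmark> + (1 - p)" by simp
  have r1: "real_of_prob ?r = 1 \<longleftrightarrow> real_of_prob q = 1"
    unfolding r using ne by (auto simp: divide_eq_eq algebra_simps)
  \<comment> \<open>If \<open>q = 1\<close>, then \<open>ne\<close> says that \<open>p\<close> is
    nonzero, so the body has value 1 at the empty word exactly if \<open>e\<close> does.\<close>
  have deg: "real_of_prob q = 1 \<and> \<partial> ?e \<checkmark> = 1 \<longleftrightarrow> real_of_prob ?r = 1 \<and> \<partial> e \<checkmark> = 1"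
    unfolding r1 t using ne by (auto simp: algebra_simps)
  show ?thesis
  proof (cases "real_of_prob q = 1 \<and> \<partial> ?e \<checkmark> = 1")
    case True
    moreover from this deg have "real_of_prob ?r = 1" "\<partial> e \<checkmark> = 1" by auto
    ultimately show ?thesis by (simp add: fun_eq_iff semantics_Loop_degenerate)
  next
    case False
    then have False': "\<not> (real_of_prob ?r = 1 \<and> \<partial> e \<checkmark> = 1)" using deg by blast
    note nz = loop_denominator_nonzero[OF False, unfolded t]
      and nz' = loop_denominator_nonzero[OF False', unfolded r]
    have alg: "(1 - y) / (1 - y * (x * c + (1 - x))) =
          (1 - x * y / (1 - (1 - x) * y)) / (1 - x * y / (1 - (1 - x) * y) * c)"
        "y / (1 - y * (x * c + (1 - x))) * x =
          x * y / (1 - (1 - x) * y) / (1 - x * y / (1 - (1 - x) * y) * c)"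
      if "1 - (1 - x) * y \<noteq> 0" "1 - y * (x * c + (1 - x)) \<noteq> 0" for x y c :: real
    proof -
      \<comment> \<open>Both are put over the denominator \<open>1 - (1 - x) * y\<close>, which
        cancels in the quotients.\<close>
      have "1 - x * y / (1 - (1 - x) * y) * c =
          (1 - y * (x * c + (1 - x))) / (1 - (1 - x) * y)"
        "1 - x * y / (1 - (1 - x) * y) = (1 - y) / (1 - (1 - x) * y)"
        using that(1) by (simp_all add: field_simps)
      then show "(1 - y) / (1 - y * (x * c + (1 - x))) =
          (1 - x * y / (1 - (1 - x) * y)) / (1 - x * y / (1 - (1 - x) * y) * c)"
        "y / (1 - y * (x * c + (1 - x))) * x =
          x * y / (1 - (1 - x) * y) / (1 - x * y / (1 - (1 - x) * y) * c)"
        using that by simp_all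
    qed
    show ?thesis
    proof (rule loop_unique[where k = "real_of_prob ?r / (1 - ?r * \<partial> e \<checkmark>)" and f = "semantics e"])
      have "semantics (?e\<^bsup>[q]\<^esup>) [] = (1 - q) / (1 - q * \<partial> ?e \<checkmark>)"
        "semantics (e\<^bsup>[?r]\<^esup>) [] = (1 - ?r) / (1 - ?r * \<partial> e \<checkmark>)"
        using False False' by auto
      then show "semantics (?e\<^bsup>[q]\<^esup>) [] = semantics (e\<^bsup>[?r]\<^esup>) []"
        unfolding r t using alg(1)[OF ne nz] by simp
    next
      fix a w
      have "semantics (?e\<^bsup>[q]\<^esup>) (a # w) = q / (1 - q * \<partial> ?e \<checkmark>) * p *
          conv (\<lambda>v. semantics e (a # v)) (semantics (?e\<^bsup>[q]\<^esup>)) w"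
        by (subst semantics_Loop_Cons[OF False])
          (simp add: semantics_Choice semantics_One conv_scale_left)
      then show "semantics (?e\<^bsup>[q]\<^esup>) (a # w) = real_of_prob ?r / (1 - ?r * \<partial> e \<checkmark>) *
          conv (\<lambda>v. semantics e (a # v)) (semantics (?e\<^bsup>[q]\<^esup>)) w"
        unfolding r t by (simp only: alg(2)[OF ne nz])
    qed (rule semantics_Loop_Cons[OF False'])
  qed
qed

section \<open>Soundness of the rules\<close>

text \<open>Turns the side condition of \<open>Unique\<close> into vanishing of the language at the
  empty word.\<close>

lemma E_eq_deriv_tick: "E e = \<partial> e \<checkmark>"
  by (induction e) auto

lemma semantics_Unique:
  assumes g: "semantics g = semantics ((e ;; g) \<oplus>\<^bsub>p\<^esub> f)" and "E e = 0"
  shows "semantics g = semantics (e\<^bsup>[p]\<^esup> ;; f)"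
proof (rule affine_fixpoint_unique)
  show "semantics e [] = 0" using assms(2) by (simp add: E_eq_deriv_tick)
  show "semantics g w = p * conv (semantics e) (semantics g) w + (1 - p) * semantics f w" for w
    by (subst g) (simp add: semantics_Choice semantics_Seq)
  show "semantics (e\<^bsup>[p]\<^esup> ;; f) w =
      p * conv (semantics e) (semantics (e\<^bsup>[p]\<^esup> ;; f)) w + (1 - p) * semantics f w" for w
  proof -
    \<comment> \<open>Unroll the loop once and multiply by \<open>f\<close> on the right: the unit
      part yields \<open>f\<close> with weight \<open>1 - p\<close>, and associativity regroups the
      rest.\<close>
    have "semantics (e\<^bsup>[p]\<^esup> ;; f) w = conv (\<lambda>v. p * conv (semantics e) (semantics (e\<^bsup>[p]\<^esup>)) v +
        (1 - p) * (if v = [] then 1 else 0)) (semantics f) w"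
      by (simp only: semantics_Seq flip: semantics_Unroll)
    also have "\<dots> = p * conv (semantics e) (conv (semantics (e\<^bsup>[p]\<^esup>)) (semantics f)) w +
        (1 - p) * semantics f w"
      by (simp only: conv_add_left conv_scale_left conv_assoc conv_one_left)
    finally show ?thesis by (simp only: semantics_Seq[abs_def])
  qed
qed

theorem theorem6p6:
  fixes e f :: "'a::finite exp"
  assumes "e \<approx> f"
  shows "semantics e = semantics f"
  using assms
proof induction
  case (cong_Loop e e' p)
  show ?case by (rule semantics_Loop_cong) fact
next
  case (C4 p q e f g)
  \<comment> \<open>Used with \<open>d = 1 - p * q\<close> and \<open>b = (1 - p) * q\<close>: the
    outer weight \<open>d\<close> cancels the inner denominator, and \<open>d - b\<close> is
    \<open>1 - q\<close>.\<close>
  have "d * (b / d * y + (1 - b / d) * z) = b * y + (d - b) * z" if "d \<noteq> 0" for b d y z :: real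
    using that by (simp add: field_simps)
  note scale = this[OF C4]
  show ?case
    unfolding fun_eq_iff semantics_Choice real_of_Prob_simps(3) real_of_Prob_simps(4)[OF C4] scale
    by (simp add: algebra_simps)
next
  case (Unroll e p)
  show ?case
    using semantics_Unroll[of e p]
    by (simp add: fun_eq_iff semantics_Choice semantics_Seq semantics_One)
next
  case (Tight p q e)
  then show ?case
    by (simp add: fun_eq_iff semantics_Seq semantics_One[abs_def] conv_one_right semantics_Tight)
next
  case Div
  show ?case by (simp add: fun_eq_iff semantics_Loop_degenerate real_of_Prob_simps)
next
  case (Unique g e p f)
  show ?case by (rule semantics_Unique) fact+
next
  case (cong_Seq e e' f f')
  then show ?case by (simp add: fun_eq_iff[of "semantics (_ ;; _)"] semantics_Seq)
next
  case (D1 e p f g)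
  show ?case
    by (simp add: fun_eq_iff semantics_Choice semantics_Choice[abs_def] semantics_Seq
        conv_add_left conv_scale_left)
next
  case (D2 e f p g)
  show ?case
    by (simp add: fun_eq_iff semantics_Choice semantics_Choice[abs_def] semantics_Seq
        conv_add_right conv_scale_right)
qed (simp_all add: fun_eq_iff semantics_Choice semantics_Seq semantics_Zero[abs_def]
    semantics_One[abs_def] semantics_Seq[abs_def] real_of_Prob_simps conv_zero_left
    conv_zero_right conv_one_left conv_one_right conv_assoc algebra_simps)

end
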